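(* Let $\mathcal A=\langle A;\Xi\rangle$ be an algebra and $f\colon A\to A$. (1) If $\mathcal A$ is sp-residually finite and $f$ preserves all finite index $\mathcal A$-stable preorders, then $f$ is $\mathcal A$-stable-preorder preserving and $\mathcal A$-congruence preserving. Consequently, for sp-residually finite $\mathcal A$, the following four conditions are equivalent: $f$ is stable-preorder preserving; $f$ preserves all finite index stable preorders; $f^{-1}(L)\in\mathrm{Latt}^{\infty}_{\mathcal A}(L)$ for all $L\subseteq A$; $f^{-1}(L)\in\mathrm{Latt}^{\emptyset,A}_{\mathcal A}(L)$ for all $\mathcal A$-recognizable $L$; and the following four conditions are equivalent: $f$ is congruence preserving; $f$ preserves all finite index congruences; $f^{-1}(L)\in\mathrm{Bool}^{\infty}_{\mathcal A}(L)$ for all $L\subseteq A$; $f^{-1}(L)\in\mathrm{Bool}^{\emptyset,A}_{\mathcal A}(L)$ for all $\mathcal A$-recognizable $L$. (2) If $\mathcal A$ is c-residually finite and $f$ preserves all finite index $\mathcal A$-congruences, then $f$ is $\mathcal A$-congruence preserving. Consequently, for c-residually finite $\mathcal A$, the last four conditions listed in (1) are equivalent.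
   Context: An algebra $\mathcal A=\langle A;\Xi\rangle$ is a nonempty set with operations. A relation is $\mathcal A$-stable if compatible with every operation (arguments pairwise related imply values related); congruences are stable equivalences; stable preorders are stable reflexive transitive relations; $f$ preserves $\rho$ if $x\rho y\Rightarrow f(x)\rho f(y)$; $f$ is congruence (resp. stable-preorder) preserving if it preserves all congruences (resp. stable preorders). Index of a congruence = number of classes; index of a stable preorder $\sqsubseteq$ = index of $\{(x,y):x\sqsubseteq y,y\sqsubseteq x\}$. $\mathcal A$ is c-residually finite (resp. sp-residually finite) if every congruence (resp. stable preorder) is the intersection of a family of finite index congruences (resp. finite index stable preorders). $L$ is $\mathcal A$-recognizable if it is a union of classes of a finite index congruence. The 1-freezifications of an operation $\xi$ of arity $n\ge2$ are the maps $x\mapsto\xi(c_1,\dots,c_{i-1},x,c_{i+1},\dots,c_n)$ with $c_j\in A$; a unary operation is its own 1-freezification; $\mathrm{Freez}^*(\mathcal A)$ is the set of finite (possibly empty) compositions of 1-freezifications. $\mathrm{Latt}^{\emptyset,A}_{\mathcal A}(L)$ (resp. $\mathrm{Bool}^{\emptyset,A}_{\mathcal A}(L)$) is the smallest family of subsets of $A$ containing $L,\emptyset,A$ closed under finite unions and intersections (resp. and complementation) and under $X\mapsto\gamma^{-1}(X)$ for all $\gamma\in\mathrm{Freez}^*(\mathcal A)$; $\mathrm{Latt}^{\infty}_{\mathcal A}(L)$ (resp. $\mathrm{Bool}^{\infty}_{\mathcal A}(L)$) is the smallest family containing $L$ closed under arbitrary (including empty) unions and intersections (resp. and complementation) and all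 $\gamma^{-1}$. *)

theory Defs
  imports "HOL-Library.FuncSet"
begin

text \<open>
  An operation is a pair \<open>(n, \<xi>)\<close> of an arity and a function on argument lists; only the values of
  \<open>\<xi>\<close> on lists of length \<open>n\<close> over the carrier matter. Nullary operations are permitted.
\<close>

type_synonym 'a operation = "nat \<times> ('a list \<Rightarrow> 'a)"

definition algebra :: "'a set \<Rightarrow> 'a operation set \<Rightarrow> bool" where
  "algebra A \<Xi> \<longleftrightarrow>
    A \<noteq> {} \<and> (\<forall>(n, \<xi>) \<in> \<Xi>. \<forall>xs. length xs = n \<and> set xs \<subseteq> A \<longrightarrow> \<xi> xs \<in> A)"

definition stable :: "'a set \<Rightarrow> 'a operation set \<Rightarrow> 'a rel \<Rightarrow> bool" where
  "stable A \<Xi> \<rho> \<longleftrightarrow>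
    (\<forall>(n, \<xi>) \<in> \<Xi>. \<forall>xs ys. length xs = n \<and> length ys = n \<and> set xs \<subseteq> A \<and> set ys \<subseteq> A \<and>
      (\<forall>i<n. (xs ! i, ys ! i) \<in> \<rho>) \<longrightarrow> (\<xi> xs, \<xi> ys) \<in> \<rho>)"

definition congruence :: "'a set \<Rightarrow> 'a operation set \<Rightarrow> 'a rel \<Rightarrow> bool" where
  "congruence A \<Xi> \<theta> \<longleftrightarrow> equiv A \<theta> \<and> stable A \<Xi> \<theta>"

definition stable_preorder :: "'a set \<Rightarrow> 'a operation set \<Rightarrow> 'a rel \<Rightarrow> bool" where
  "stable_preorder A \<Xi> \<rho> \<longleftrightarrow> preorder_on A \<rho> \<and> stable A \<Xi> \<rho>"

definition finite_index_congruence :: "'a set \<Rightarrow> 'a operation set \<Rightarrow> 'a rel \<Rightarrow> bool" where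
  "finite_index_congruence A \<Xi> \<theta> \<longleftrightarrow> congruence A \<Xi> \<theta> \<and> finite (A // \<theta>)"

definition finite_index_stable_preorder :: "'a set \<Rightarrow> 'a operation set \<Rightarrow> 'a rel \<Rightarrow> bool" where
  "finite_index_stable_preorder A \<Xi> \<rho> \<longleftrightarrow>
    stable_preorder A \<Xi> \<rho> \<and> finite (A // {(x, y). (x, y) \<in> \<rho> \<and> (y, x) \<in> \<rho>})"

definition preserves :: "('a \<Rightarrow> 'a) \<Rightarrow> 'a rel \<Rightarrow> bool" where
  "preserves f \<rho> \<longleftrightarrow> (\<forall>x y. (x, y) \<in> \<rho> \<longrightarrow> (f x, f y) \<in> \<rho>)"

definition congruence_preserving :: "'a set \<Rightarrow> 'a operation set \<Rightarrow> ('a \<Rightarrow> 'a) \<Rightarrow> bool" where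
  "congruence_preserving A \<Xi> f \<longleftrightarrow> (\<forall>\<theta>. congruence A \<Xi> \<theta> \<longrightarrow> preserves f \<theta>)"

definition stable_preorder_preserving :: "'a set \<Rightarrow> 'a operation set \<Rightarrow> ('a \<Rightarrow> 'a) \<Rightarrow> bool" where
  "stable_preorder_preserving A \<Xi> f \<longleftrightarrow> (\<forall>\<rho>. stable_preorder A \<Xi> \<rho> \<longrightarrow> preserves f \<rho>)"

text \<open>The factor \<open>A \<times> A\<close> makes the intersection of the empty family of relations the full relation on \<open>A\<close>.\<close>

definition c_residually_finite :: "'a set \<Rightarrow> 'a operation set \<Rightarrow> bool" where
  "c_residually_finite A \<Xi> \<longleftrightarrow>
    (\<forall>\<theta>. congruence A \<Xi> \<theta> \<longrightarrow>
      (\<exists>\<F>. (\<forall>\<phi>\<in>\<F>. finite_index_congruence A \<Xi> \<phi>) \<and> \<theta> = (A \<times> A) \<inter> \<Inter>\<F>))"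

definition sp_residually_finite :: "'a set \<Rightarrow> 'a operation set \<Rightarrow> bool" where
  "sp_residually_finite A \<Xi> \<longleftrightarrow>
    (\<forall>\<rho>. stable_preorder A \<Xi> \<rho> \<longrightarrow>
      (\<exists>\<F>. (\<forall>\<sigma>\<in>\<F>. finite_index_stable_preorder A \<Xi> \<sigma>) \<and> \<rho> = (A \<times> A) \<inter> \<Inter>\<F>))"

definition recognizable :: "'a set \<Rightarrow> 'a operation set \<Rightarrow> 'a set \<Rightarrow> bool" where
  "recognizable A \<Xi> L \<longleftrightarrow>
    (\<exists>\<theta>. finite_index_congruence A \<Xi> \<theta> \<and> (\<exists>\<C>. \<C> \<subseteq> A // \<theta> \<and> L = \<Union>\<C>))"

inductive_set freezifications1 :: "'a set \<Rightarrow> 'a operation set \<Rightarrow> ('a \<Rightarrow> 'a) set"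
  for A :: "'a set" and \<Xi> :: "'a operation set" where
  unary: "(1, \<xi>) \<in> \<Xi> \<Longrightarrow> (\<lambda>x. \<xi> [x]) \<in> freezifications1 A \<Xi>"
| freeze: "\<lbrakk>(n, \<xi>) \<in> \<Xi>; n \<ge> 2; set us \<subseteq> A; set vs \<subseteq> A; length us + 1 + length vs = n\<rbrakk>
    \<Longrightarrow> (\<lambda>x. \<xi> (us @ [x] @ vs)) \<in> freezifications1 A \<Xi>"

inductive_set Freez_star :: "'a set \<Rightarrow> 'a operation set \<Rightarrow> ('a \<Rightarrow> 'a) set"
  for A :: "'a set" and \<Xi> :: "'a operation set" where
  id: "id \<in> Freez_star A \<Xi>"
| comp: "\<lbrakk>\<gamma> \<in> freezifications1 A \<Xi>; \<delta> \<in> Freez_star A \<Xi>\<rbrakk> \<Longrightarrow> \<gamma> \<circ> \<delta> \<in> Freez_star A \<Xi>"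

definition preimage_on :: "'a set \<Rightarrow> ('a \<Rightarrow> 'a) \<Rightarrow> 'a set \<Rightarrow> 'a set" where
  "preimage_on A g X = {x \<in> A. g x \<in> X}"

inductive_set Latt_fin :: "'a set \<Rightarrow> 'a operation set \<Rightarrow> 'a set \<Rightarrow> 'a set set"
  for A :: "'a set" and \<Xi> :: "'a operation set" and L :: "'a set" where
  base: "L \<in> Latt_fin A \<Xi> L"
| empty: "{} \<in> Latt_fin A \<Xi> L"
| carrier: "A \<in> Latt_fin A \<Xi> L"
| union: "\<lbrakk>X \<in> Latt_fin A \<Xi> L; Y \<in> Latt_fin A \<Xi> L\<rbrakk> \<Longrightarrow> X \<union> Y \<in> Latt_fin A \<Xi> L"
| inter: "\<lbrakk>X \<in> Latt_fin A \<Xi> L; Y \<in> Latt_fin A \<Xi> L\<rbrakk> \<Longrightarrow> X \<inter> Y \<in> Latt_fin A \<Xi> L"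
| preimage: "\<lbrakk>X \<in> Latt_fin A \<Xi> L; \<gamma> \<in> Freez_star A \<Xi>\<rbrakk> \<Longrightarrow> preimage_on A \<gamma> X \<in> Latt_fin A \<Xi> L"

inductive_set Bool_fin :: "'a set \<Rightarrow> 'a operation set \<Rightarrow> 'a set \<Rightarrow> 'a set set"
  for A :: "'a set" and \<Xi> :: "'a operation set" and L :: "'a set" where
  base: "L \<in> Bool_fin A \<Xi> L"
| empty: "{} \<in> Bool_fin A \<Xi> L"
| carrier: "A \<in> Bool_fin A \<Xi> L"
| union: "\<lbrakk>X \<in> Bool_fin A \<Xi> L; Y \<in> Bool_fin A \<Xi> L\<rbrakk> \<Longrightarrow> X \<union> Y \<in> Bool_fin A \<Xi> L"
| inter: "\<lbrakk>X \<in> Bool_fin A \<Xi> L; Y \<in> Bool_fin A \<Xi> L\<rbrakk> \<Longrightarrow> X \<inter> Y \<in> Bool_fin A \<Xi> L"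
| compl: "X \<in> Bool_fin A \<Xi> L \<Longrightarrow> A - X \<in> Bool_fin A \<Xi> L"
| preimage: "\<lbrakk>X \<in> Bool_fin A \<Xi> L; \<gamma> \<in> Freez_star A \<Xi>\<rbrakk> \<Longrightarrow> preimage_on A \<gamma> X \<in> Bool_fin A \<Xi> L"

text \<open>
  In the two complete versions the family \<open>\<F>\<close> may be infinite or empty; intersections are taken
  within \<open>A\<close>, so the empty union is \<open>{}\<close> and the empty intersection is \<open>A\<close>.
\<close>

inductive_set Latt_inf :: "'a set \<Rightarrow> 'a operation set \<Rightarrow> 'a set \<Rightarrow> 'a set set"
  for A :: "'a set" and \<Xi> :: "'a operation set" and L :: "'a set" where
  base: "L \<in> Latt_inf A \<Xi> L"
| union: "(\<And>X. X \<in> \<F> \<Longrightarrow> X \<in> Latt_inf A \<Xi> L) \<Longrightarrow> \<Union>\<F> \<in> Latt_inf A \<Xi> L"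
| inter: "(\<And>X. X \<in> \<F> \<Longrightarrow> X \<in> Latt_inf A \<Xi> L) \<Longrightarrow> A \<inter> \<Inter>\<F> \<in> Latt_inf A \<Xi> L"
| preimage: "\<lbrakk>X \<in> Latt_inf A \<Xi> L; \<gamma> \<in> Freez_star A \<Xi>\<rbrakk> \<Longrightarrow> preimage_on A \<gamma> X \<in> Latt_inf A \<Xi> L"

inductive_set Bool_inf :: "'a set \<Rightarrow> 'a operation set \<Rightarrow> 'a set \<Rightarrow> 'a set set"
  for A :: "'a set" and \<Xi> :: "'a operation set" and L :: "'a set" where
  base: "L \<in> Bool_inf A \<Xi> L"
| union: "(\<And>X. X \<in> \<F> \<Longrightarrow> X \<in> Bool_inf A \<Xi> L) \<Longrightarrow> \<Union>\<F> \<in> Bool_inf A \<Xi> L"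
| inter: "(\<And>X. X \<in> \<F> \<Longrightarrow> X \<in> Bool_inf A \<Xi> L) \<Longrightarrow> A \<inter> \<Inter>\<F> \<in> Bool_inf A \<Xi> L"
| compl: "X \<in> Bool_inf A \<Xi> L \<Longrightarrow> A - X \<in> Bool_inf A \<Xi> L"
| preimage: "\<lbrakk>X \<in> Bool_inf A \<Xi> L; \<gamma> \<in> Freez_star A \<Xi>\<rbrakk> \<Longrightarrow> preimage_on A \<gamma> X \<in> Bool_inf A \<Xi> L"

end

theory Submission
  imports Defs
begin

text \<open>
  For a family \<open>\<D>\<close> of sets closed under preimages by freezifications, the relation
  ``every member of \<open>\<D>\<close> containing \<open>a\<close> contains \<open>x\<close>'' is a stable preorder, and a congruence if
  \<open>\<D>\<close> is also closed under complements. Take for \<open>\<D>\<close> the lattice (or Boolean algebra) generated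
  by \<open>L\<close>. If \<open>f\<close> preserves this preorder, then \<open>f\<^sup>-\<^sup>1(L)\<close> is an up-set, that is, the
  union over its points \<open>a\<close> of the intersections \<open>\<Inter>{X \<in> \<D>. a \<in> X}\<close>. When \<open>L\<close> is
  recognizable, \<open>\<D>\<close> is finite, so the preorder has finite index and all these unions and
  intersections are finite. Conversely, a stable preorder \<open>\<rho>\<close> is preserved by \<open>f\<close> as
  soon as each \<open>f\<^sup>-\<^sup>1({z. f(x) \<rho> z})\<close> is a \<open>\<rho>\<close>-up-set, and all members of the lattice generated by
  a \<open>\<rho>\<close>-up-set are \<open>\<rho>\<close>-up-sets. Residual finiteness enters only to pass from relations of finite
  index to arbitrary ones.
\<close>

section \<open>Freezifications and stable preorders\<close>

lemma stable_preorderD: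
  assumes "stable_preorder A \<Xi> \<rho>"
  shows "\<rho> \<subseteq> A \<times> A" "refl_on A \<rho>" "trans \<rho>" "stable A \<Xi> \<rho>"
  using assms by (auto simp: stable_preorder_def preorder_on_def)

text \<open>Lets every result on stable preorders be reused for congruences, with symmetry as an
  extra assumption.\<close>

lemma congruence_iff_sym_stable_preorder:
  "congruence A \<Xi> \<theta> \<longleftrightarrow> stable_preorder A \<Xi> \<theta> \<and> sym \<theta>"
  by (auto simp: congruence_def stable_preorder_def preorder_on_def equiv_def)

lemma stable_iff_list_all2:
  "stable A \<Xi> \<rho> \<longleftrightarrow>
    (\<forall>(n, \<xi>) \<in> \<Xi>. \<forall>xs ys. length xs = n \<and> set xs \<subseteq> A \<and> set ys \<subseteq> A \<and>
      list_all2 (\<lambda>x y. (x, y) \<in> \<rho>) xs ys \<longrightarrow> (\<xi> xs, \<xi> ys) \<in> \<rho>)"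
  unfolding stable_def list_all2_conv_all_nth by fastforce

text \<open>For \<open>n = 1\<close> both contexts are empty, and a unary operation is its own
  freezification; so one shape of context covers both introduction rules.\<close>

lemma freezificationI:
  assumes "(n, \<xi>) \<in> \<Xi>" "set us \<subseteq> A" "set vs \<subseteq> A" "length us + 1 + length vs = n"
  shows "(\<lambda>x. \<xi> (us @ [x] @ vs)) \<in> freezifications1 A \<Xi>"
proof (cases "n \<ge> 2")
  case True
  with assms show ?thesis by (intro freeze)
next
  case False
  with assms(4) have "length us = 0" "length vs = 0" by linarith+
  with assms(4) have "n = 1" "us = []" "vs = []" by auto
  with assms(1) show ?thesis by (auto intro: unary)
qed

lemma freezification_cases:
  assumes "\<gamma> \<in> freezifications1 A \<Xi>"
  obtains n \<xi> us vs where "(n, \<xi>) \<in> \<Xi>" "set us \<subseteq> A" "set vs \<subseteq> A" "length us + 1 + length vs = n"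
    "\<gamma> = (\<lambda>x. \<xi> (us @ [x] @ vs))"
  using assms
proof cases
  case (unary \<xi>)
  then show ?thesis using that[of 1 \<xi> "[]" "[]"] by simp
qed (blast intro: that)

lemma freezification_in_carrier:
  assumes "algebra A \<Xi>" "\<gamma> \<in> freezifications1 A \<Xi>" "x \<in> A"
  shows "\<gamma> x \<in> A"
proof -
  from assms(2) obtain n \<xi> us vs where *: "(n, \<xi>) \<in> \<Xi>" "set us \<subseteq> A" "set vs \<subseteq> A"
    "length us + 1 + length vs = n" "\<gamma> = (\<lambda>x. \<xi> (us @ [x] @ vs))"
    by (rule freezification_cases)
  have "length (us @ [x] @ vs) = n" "set (us @ [x] @ vs) \<subseteq> A" using * assms(3) by auto
  then show ?thesis using assms(1) * unfolding algebra_def by fast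
qed

lemma freezification_subset_Freez_star: "freezifications1 A \<Xi> \<subseteq> Freez_star A \<Xi>"
  using Freez_star.comp[OF _ Freez_star.id] by fastforce

lemma stable_iff_freezifications_preserve:
  assumes "algebra A \<Xi>" "preorder_on A \<rho>"
  shows "stable A \<Xi> \<rho> \<longleftrightarrow> (\<forall>\<gamma> \<in> freezifications1 A \<Xi>. preserves \<gamma> \<rho>)"
proof
  have \<rho>: "\<rho> \<subseteq> A \<times> A" "refl_on A \<rho>" "trans \<rho>" using assms(2) by (auto simp: preorder_on_def)
  {
    assume stable: "stable A \<Xi> \<rho>"
    have "preserves \<gamma> \<rho>" if "\<gamma> \<in> freezifications1 A \<Xi>" for \<gamma>
      unfolding preserves_def
    proof (intro allI impI)
      fix x y
      assume xy: "(x, y) \<in> \<rho>"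
      from that obtain n \<xi> us vs where *: "(n, \<xi>) \<in> \<Xi>" "set us \<subseteq> A" "set vs \<subseteq> A"
        "length us + 1 + length vs = n" "\<gamma> = (\<lambda>x. \<xi> (us @ [x] @ vs))"
        by (rule freezification_cases)
      have refl: "list_all2 (\<lambda>x y. (x, y) \<in> \<rho>) ws ws" if "set ws \<subseteq> A" for ws
        using that \<rho>(2) by (induction ws) (auto simp: refl_on_def)
      have "list_all2 (\<lambda>x y. (x, y) \<in> \<rho>) (us @ [x] @ vs) (us @ [y] @ vs)"
        using xy refl[OF *(2)] refl[OF *(3)] by (simp add: list_all2_appendI)
      moreover have "length (us @ [x] @ vs) = n" "set (us @ [x] @ vs) \<subseteq> A"
        "set (us @ [y] @ vs) \<subseteq> A" using * xy \<rho>(1) by auto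
      ultimately have "(\<xi> (us @ [x] @ vs), \<xi> (us @ [y] @ vs)) \<in> \<rho>"
        using stable *(1) unfolding stable_iff_list_all2 by blast
      then show "(\<gamma> x, \<gamma> y) \<in> \<rho>" using *(5) by simp
    qed
    then show "\<forall>\<gamma> \<in> freezifications1 A \<Xi>. preserves \<gamma> \<rho>" by blast
  next
    assume pres: "\<forall>\<gamma> \<in> freezifications1 A \<Xi>. preserves \<gamma> \<rho>"
    \<comment> \<open>The arguments are replaced one at a time, from left to right.\<close>
    have main: "(\<xi> (us @ xs), \<xi> (us @ ys)) \<in> \<rho>"
      if "(n, \<xi>) \<in> \<Xi>" "list_all2 (\<lambda>x y. (x, y) \<in> \<rho>) xs ys" "set us \<subseteq> A" "set xs \<subseteq> A" "set ys \<subseteq> A"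
        "length us + length xs = n" for n \<xi> us xs ys
      using that(2-)
    proof (induction arbitrary: us rule: list_all2_induct)
      \<comment> \<open>With \<open>us\<close> empty this is also the case of nullary operations:
        the value lies in \<open>A\<close>, so reflexivity applies.\<close>
      case Nil
      then have "\<xi> us \<in> A" using assms(1) that(1) unfolding algebra_def by fastforce
      then show ?case using \<rho>(2) by (simp add: refl_on_def)
    next
      case (Cons x xs y ys)
      have "(\<lambda>z. \<xi> (us @ [z] @ xs)) \<in> freezifications1 A \<Xi>"
        using that(1) Cons.prems by (intro freezificationI) auto
      with pres have "preserves (\<lambda>z. \<xi> (us @ [z] @ xs)) \<rho>" by (rule bspec)
      with Cons.hyps(1) have "(\<xi> (us @ [x] @ xs), \<xi> (us @ [y] @ xs)) \<in> \<rho>"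
        by (simp add: preserves_def)
      \<comment> \<open>The argument \<open>y\<close> just inserted joins the prefix, which is why
        \<open>us\<close> is kept arbitrary in the induction.\<close>
      moreover have "(\<xi> ((us @ [y]) @ xs), \<xi> ((us @ [y]) @ ys)) \<in> \<rho>"
        using Cons.prems by (intro Cons.IH) auto
      ultimately show ?case using \<rho>(3) by (auto dest: transD)
    qed
    show "stable A \<Xi> \<rho>"
      unfolding stable_iff_list_all2 using main[where us = "[]"] by auto
  }
qed

lemma Freez_star_preserves:
  assumes "algebra A \<Xi>" "stable_preorder A \<Xi> \<rho>" "\<gamma> \<in> Freez_star A \<Xi>"
  shows "preserves \<gamma> \<rho>"
  using assms(3)
proof induction
  case (comp \<gamma> \<delta>)
  then have "preserves \<gamma> \<rho>"
    using stable_iff_freezifications_preserve assms(1,2) by (auto simp: stable_preorder_def)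
  with comp.IH show ?case by (simp add: preserves_def)
qed (simp add: preserves_def)

text \<open>This is the congruence whose classes are counted by the index of \<open>\<rho>\<close>.
  Stability holds for each of the two orders separately.\<close>

lemma stable_preorder_Int_converse:
  assumes "stable_preorder A \<Xi> \<rho>"
  shows "congruence A \<Xi> (\<rho> \<inter> \<rho>\<inverse>)"
  unfolding congruence_iff_sym_stable_preorder stable_preorder_def preorder_on_def
proof (intro conjI)
  show "stable A \<Xi> (\<rho> \<inter> \<rho>\<inverse>)"
    using stable_preorderD(4)[OF assms] unfolding stable_def by fastforce
qed (use stable_preorderD[OF assms] in \<open>auto simp: refl_on_def sym_def intro: trans_Int\<close>)

lemma finite_index_stable_preorder_iff:
  "finite_index_stable_preorder A \<Xi> \<rho> \<longleftrightarrow>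
    stable_preorder A \<Xi> \<rho> \<and> finite_index_congruence A \<Xi> (\<rho> \<inter> \<rho>\<inverse>)"
proof -
  have "{(x, y). (x, y) \<in> \<rho> \<and> (y, x) \<in> \<rho>} = \<rho> \<inter> \<rho>\<inverse>" by auto
  then show ?thesis
    using stable_preorder_Int_converse
    by (auto simp: finite_index_stable_preorder_def finite_index_congruence_def)
qed

text \<open>A symmetric relation equals its intersection with its converse, so the two notions of
  index agree.\<close>

lemma finite_index_congruence_iff:
  "finite_index_congruence A \<Xi> \<theta> \<longleftrightarrow> finite_index_stable_preorder A \<Xi> \<theta> \<and> sym \<theta>"
proof -
  have "\<theta> \<inter> \<theta>\<inverse> = \<theta>" if "sym \<theta>" using that by (auto simp: sym_def)
  then show ?thesis
    unfolding finite_index_stable_preorder_iff finite_index_congruence_def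
    by (auto simp: congruence_iff_sym_stable_preorder)
qed

section \<open>The specialization preorder of a family of sets\<close>

text \<open>Reading \<open>\<D>\<close> as a family of open sets, this is the specialization
  preorder of topology, oriented so that open sets are upward closed.\<close>

definition specialization :: "'a set \<Rightarrow> 'a set set \<Rightarrow> 'a rel" where
  "specialization A \<D> = {(x, y) \<in> A \<times> A. \<forall>X\<in>\<D>. x \<in> X \<longrightarrow> y \<in> X}"

text \<open>If \<open>X\<close> contains \<open>\<gamma> x\<close>, then the preimage of
  \<open>X\<close> under \<open>\<gamma>\<close> is a member of \<open>\<D>\<close> containing
  \<open>x\<close>, hence every \<open>y\<close> above \<open>x\<close>; so \<open>X\<close>
  contains \<open>\<gamma> y\<close>.\<close>

lemma stable_preorder_specialization:
  assumes "algebra A \<Xi>" "\<And>X \<gamma>. X \<in> \<D> \<Longrightarrow> \<gamma> \<in> Freez_star A \<Xi> \<Longrightarrow> preimage_on A \<gamma> X \<in> \<D>"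
  shows "stable_preorder A \<Xi> (specialization A \<D>)"
proof -
  have pre: "preorder_on A (specialization A \<D>)"
    by (auto simp: preorder_on_def specialization_def refl_on_def trans_def)
  have "preserves \<gamma> (specialization A \<D>)" if \<gamma>: "\<gamma> \<in> freezifications1 A \<Xi>" for \<gamma>
  proof -
    have "preimage_on A \<gamma> X \<in> \<D>" if "X \<in> \<D>" for X
      using assms(2) that \<gamma> freezification_subset_Freez_star by blast
    then show ?thesis
      using freezification_in_carrier[OF assms(1) \<gamma>]
      by (fastforce simp: preserves_def specialization_def preimage_on_def)
  qed
  then show ?thesis
    using stable_iff_freezifications_preserve[OF assms(1) pre] pre by (simp add: stable_preorder_def)
qed

text \<open>If a member \<open>X\<close> contained \<open>y\<close> but not \<open>x\<close>, its
  complement would be a member containing \<open>x\<close> but not \<open>y\<close>.\<close>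

lemma sym_specialization:
  assumes "\<And>X. X \<in> \<D> \<Longrightarrow> A - X \<in> \<D>"
  shows "sym (specialization A \<D>)"
proof (rule symI)
  fix x y
  assume xy: "(x, y) \<in> specialization A \<D>"
  have "x \<in> X" if "X \<in> \<D>" "y \<in> X" for X
    using xy assms[OF that(1)] that(2) by (fastforce simp: specialization_def)
  with xy show "(y, x) \<in> specialization A \<D>" by (simp add: specialization_def)
qed

text \<open>For \<open>a\<close> in \<open>A\<close>, the intersection is the principal up-set of
  \<open>a\<close>. If \<open>x\<close> belongs to it, then \<open>f x\<close> is above
  \<open>f a\<close>, and the member \<open>L\<close> of \<open>\<D>\<close> contains
  \<open>f x\<close> along with \<open>f a\<close>.\<close>

lemma preimage_on_eq_Union_specialization:
  assumes "preserves f (specialization A \<D>)" "L \<in> \<D>"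
  shows "preimage_on A f L = (\<Union>a\<in>preimage_on A f L. A \<inter> \<Inter>{X \<in> \<D>. a \<in> X})"
proof
  show "(\<Union>a\<in>preimage_on A f L. A \<inter> \<Inter>{X \<in> \<D>. a \<in> X}) \<subseteq> preimage_on A f L"
  proof
    fix x
    assume "x \<in> (\<Union>a\<in>preimage_on A f L. A \<inter> \<Inter>{X \<in> \<D>. a \<in> X})"
    then obtain a where a: "a \<in> A" "f a \<in> L" and "(a, x) \<in> specialization A \<D>"
      by (auto simp: preimage_on_def specialization_def)
    then have "(f a, f x) \<in> specialization A \<D>" "x \<in> A"
      using assms(1) by (auto simp: preserves_def specialization_def)
    with a(2) assms(2) show "x \<in> preimage_on A f L"
      by (auto simp: specialization_def preimage_on_def)
  qed
qed (auto simp: preimage_on_def)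

text \<open>A saturated set is the union of the classes of its points, so it is determined by a
  subset of the finite quotient.\<close>

lemma finite_saturated_sets:
  assumes "equiv A \<theta>" "finite (A // \<theta>)"
  shows "finite {X. X \<subseteq> A \<and> \<theta> `` X \<subseteq> X}"
proof (rule finite_subset)
  show "{X. X \<subseteq> A \<and> \<theta> `` X \<subseteq> X} \<subseteq> Union ` Pow (A // \<theta>)"
  proof
    fix X
    assume "X \<in> {X. X \<subseteq> A \<and> \<theta> `` X \<subseteq> X}"
    then have "X = (\<Union>x\<in>X. \<theta> `` {x})"
      using equiv_class_self[OF assms(1)] by blast
    moreover have "(\<lambda>x. \<theta> `` {x}) ` X \<in> Pow (A // \<theta>)"
      using \<open>X \<in> _\<close> by (auto intro: quotientI)
    ultimately show "X \<in> Union ` Pow (A // \<theta>)" by blast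
  qed
  show "finite (Union ` Pow (A // \<theta>))" using assms(2) by simp
qed

text \<open>Replaces the family of classes by closure under \<open>\<theta>\<close>, the form in
  which recognizability is compared with up-sets.\<close>

lemma recognizable_iff:
  "recognizable A \<Xi> L \<longleftrightarrow> L \<subseteq> A \<and> (\<exists>\<theta>. finite_index_congruence A \<Xi> \<theta> \<and> \<theta> `` L \<subseteq> L)"
proof
  assume "recognizable A \<Xi> L"
  then obtain \<theta> \<C> where *: "finite_index_congruence A \<Xi> \<theta>" "\<C> \<subseteq> A // \<theta>" "L = \<Union>\<C>"
    unfolding recognizable_def by blast
  then have eq: "equiv A \<theta>" by (simp add: finite_index_congruence_def congruence_def)
  have "y \<in> C" if "C \<in> \<C>" "x \<in> C" "(x, y) \<in> \<theta>" for C x y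
    using that *(2) eq by (metis in_quotient_imp_closed subsetD)
  moreover have "L \<subseteq> A" using * eq in_quotient_imp_subset by blast
  ultimately show "L \<subseteq> A \<and> (\<exists>\<theta>. finite_index_congruence A \<Xi> \<theta> \<and> \<theta> `` L \<subseteq> L)"
    using * by blast
next
  assume "L \<subseteq> A \<and> (\<exists>\<theta>. finite_index_congruence A \<Xi> \<theta> \<and> \<theta> `` L \<subseteq> L)"
  then obtain \<theta> where *: "L \<subseteq> A" "finite_index_congruence A \<Xi> \<theta>" "\<theta> `` L \<subseteq> L" by blast
  then have eq: "equiv A \<theta>" by (simp add: finite_index_congruence_def congruence_def)
  have "L = \<Union>((\<lambda>x. \<theta> `` {x}) ` L)" using * equiv_class_self[OF eq] by blast
  moreover have "(\<lambda>x. \<theta> `` {x}) ` L \<subseteq> A // \<theta>" using * by (auto intro: quotientI)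
  ultimately show "recognizable A \<Xi> L" unfolding recognizable_def using *(2) by blast
qed

text \<open>Since all members of \<open>\<D>\<close> are saturated, \<open>\<theta>\<close> refines
  the preorder and, being symmetric, also the associated equivalence; a coarser equivalence still
  has finitely many classes.\<close>

lemma finite_index_specialization:
  assumes "finite_index_congruence A \<Xi> \<theta>" "\<And>X. X \<in> \<D> \<Longrightarrow> \<theta> `` X \<subseteq> X"
    "stable_preorder A \<Xi> (specialization A \<D>)"
  shows "finite_index_stable_preorder A \<Xi> (specialization A \<D>)"
proof -
  let ?\<sigma> = "specialization A \<D>"
  have \<theta>: "equiv A \<theta>" "finite (A // \<theta>)" "\<theta> \<subseteq> A \<times> A" "sym \<theta>"
    using assms(1) by (auto simp: finite_index_congruence_def congruence_def equiv_def)
  have "\<theta> \<subseteq> ?\<sigma>" using assms(2) \<theta>(3) unfolding specialization_def by blast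
  then have "\<theta> \<subseteq> ?\<sigma> \<inter> ?\<sigma>\<inverse>" using \<theta>(4) by (auto dest: symD)
  moreover have cong: "congruence A \<Xi> (?\<sigma> \<inter> ?\<sigma>\<inverse>)" using stable_preorder_Int_converse[OF assms(3)] .
  ultimately have "finite (A // (?\<sigma> \<inter> ?\<sigma>\<inverse>))"
    using finite_refines_finite[OF \<theta>(2) _ \<theta>(1)] by (simp add: congruence_def)
  with cong assms(3) show ?thesis
    by (simp add: finite_index_stable_preorder_iff finite_index_congruence_def)
qed

text \<open>It suffices to test the principal up-set of \<open>f x\<close>: reflexivity puts
  \<open>f x\<close> in it and transitivity makes it an up-set. Its preimage contains
  \<open>x\<close>, hence also \<open>y\<close>.\<close>

lemma preserves_if_preimage_upsets:
  assumes "stable_preorder A \<Xi> \<rho>" "f \<in> A \<rightarrow> A"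
    "\<And>L. L \<subseteq> A \<Longrightarrow> \<rho> `` L \<subseteq> L \<Longrightarrow> \<rho> `` preimage_on A f L \<subseteq> preimage_on A f L"
  shows "preserves f \<rho>"
  unfolding preserves_def
proof (intro allI impI)
  fix x y
  assume xy: "(x, y) \<in> \<rho>"
  note \<rho> = stable_preorderD[OF assms(1)]
  let ?L = "\<rho> `` {f x}"
  have "x \<in> preimage_on A f ?L"
    using xy \<rho>(1,2) assms(2) by (auto simp: preimage_on_def refl_on_def)
  moreover have "\<rho> `` preimage_on A f ?L \<subseteq> preimage_on A f ?L"
    using \<rho>(1,3) by (intro assms(3)) (auto dest: transD)
  ultimately have "y \<in> preimage_on A f ?L" using xy by blast
  then show "(f x, f y) \<in> \<rho>" by (simp add: preimage_on_def)
qed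

section \<open>Lattices and Boolean algebras generated by a set\<close>

lemma upset_preimage_on:
  assumes "algebra A \<Xi>" "stable_preorder A \<Xi> \<rho>" "\<gamma> \<in> Freez_star A \<Xi>" "\<rho> `` X \<subseteq> X"
  shows "\<rho> `` preimage_on A \<gamma> X \<subseteq> preimage_on A \<gamma> X"
  using Freez_star_preserves[OF assms(1-3)] stable_preorderD(1)[OF assms(2)] assms(4)
  by (fastforce simp: preimage_on_def preserves_def)

text \<open>By symmetry, a point of \<open>X\<close> above a point outside \<open>X\<close> would
  force the latter into \<open>X\<close>.\<close>

lemma upset_compl:
  assumes "stable_preorder A \<Xi> \<rho>" "sym \<rho>" "\<rho> `` X \<subseteq> X"
  shows "\<rho> `` (A - X) \<subseteq> A - X"
  using assms stable_preorderD(1)[OF assms(1)] by (auto dest: symD)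

text \<open>Being an up-set survives each rule of generation. The same induction serves the three
  variants below, where symmetry takes care of complements.\<close>

lemma Latt_fin_upset:
  assumes "algebra A \<Xi>" "stable_preorder A \<Xi> \<rho>" "\<rho> `` L \<subseteq> L" "X \<in> Latt_fin A \<Xi> L"
  shows "\<rho> `` X \<subseteq> X"
  using assms(4)
proof induction
  case (preimage X \<gamma>)
  then show ?case using upset_preimage_on assms(1,2) by blast
qed (use assms(3) stable_preorderD(1)[OF assms(2)] in blast)+

lemma Bool_fin_upset:
  assumes "algebra A \<Xi>" "stable_preorder A \<Xi> \<rho>" "sym \<rho>" "\<rho> `` L \<subseteq> L" "X \<in> Bool_fin A \<Xi> L"
  shows "\<rho> `` X \<subseteq> X"
  using assms(5)
proof induction
  case (preimage X \<gamma>)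
  then show ?case using upset_preimage_on assms(1,2) by blast
next
  case (compl X)
  then show ?case using upset_compl assms(2,3) by blast
qed (use assms(4) stable_preorderD(1)[OF assms(2)] in blast)+

lemma Latt_inf_upset:
  assumes "algebra A \<Xi>" "stable_preorder A \<Xi> \<rho>" "\<rho> `` L \<subseteq> L" "X \<in> Latt_inf A \<Xi> L"
  shows "\<rho> `` X \<subseteq> X"
  using assms(4)
proof induction
  case (preimage X \<gamma>)
  then show ?case using upset_preimage_on assms(1,2) by blast
qed (use assms(3) stable_preorderD(1)[OF assms(2)] in blast)+

lemma Bool_inf_upset:
  assumes "algebra A \<Xi>" "stable_preorder A \<Xi> \<rho>" "sym \<rho>" "\<rho> `` L \<subseteq> L" "X \<in> Bool_inf A \<Xi> L"
  shows "\<rho> `` X \<subseteq> X"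
  using assms(5)
proof induction
  case (preimage X \<gamma>)
  then show ?case using upset_preimage_on assms(1,2) by blast
next
  case (compl X)
  then show ?case using upset_compl assms(2,3) by blast
qed (use assms(4) stable_preorderD(1)[OF assms(2)] in blast)+

lemma Latt_fin_subset:
  assumes "L \<subseteq> A" "X \<in> Latt_fin A \<Xi> L"
  shows "X \<subseteq> A"
  using assms(2) by induction (use assms(1) in \<open>auto simp: preimage_on_def\<close>)

lemma Bool_fin_subset:
  assumes "L \<subseteq> A" "X \<in> Bool_fin A \<Xi> L"
  shows "X \<subseteq> A"
  using assms(2) by induction (use assms(1) in \<open>auto simp: preimage_on_def\<close>)

text \<open>Finiteness of \<open>\<D>\<close> turns the union of principal up-sets into a finite
  union of finite intersections. Stated for an abstract \<open>\<D>\<close>, it applies to both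
  \<open>Latt_fin\<close> and \<open>Bool_fin\<close>.\<close>

lemma preimage_on_in_finite_lattice:
  assumes "finite \<D>" "L \<in> \<D>" "{} \<in> \<D>" "A \<in> \<D>"
    "\<And>X Y. X \<in> \<D> \<Longrightarrow> Y \<in> \<D> \<Longrightarrow> X \<union> Y \<in> \<D>" "\<And>X Y. X \<in> \<D> \<Longrightarrow> Y \<in> \<D> \<Longrightarrow> X \<inter> Y \<in> \<D>"
    "preserves f (specialization A \<D>)"
  shows "preimage_on A f L \<in> \<D>"
proof -
  have Inter: "A \<inter> \<Inter>\<F> \<in> \<D>" if "finite \<F>" "\<F> \<subseteq> \<D>" for \<F>
    using that
  proof (induction \<F>)
    case (insert X \<F>)
    have "A \<inter> \<Inter>(insert X \<F>) = X \<inter> (A \<inter> \<Inter>\<F>)" by auto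
    with insert assms(6) show ?case by auto
  qed (use assms(4) in auto)
  have Union: "\<Union>\<F> \<in> \<D>" if "finite \<F>" "\<F> \<subseteq> \<D>" for \<F>
    using that by (induction \<F>) (use assms(3,5) in auto)
  have "A \<inter> \<Inter>{X \<in> \<D>. a \<in> X} \<in> \<D>" for a
    using assms(1) by (intro Inter) auto
  \<comment> \<open>The points \<open>a\<close> may be infinitely many, but their principal up-sets
    all lie in the finite \<open>\<D>\<close>.\<close>
  then have sub: "(\<lambda>a. A \<inter> \<Inter>{X \<in> \<D>. a \<in> X}) ` preimage_on A f L \<subseteq> \<D>" by blast
  show ?thesis
    using Union[OF finite_subset[OF sub assms(1)] sub]
      preimage_on_eq_Union_specialization[OF assms(7,2)] by simp
qed

section \<open>Preservation in terms of preimages\<close>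

lemma stable_preorder_preserving_iff_Latt_inf:
  assumes "algebra A \<Xi>" "f \<in> A \<rightarrow> A"
  shows "stable_preorder_preserving A \<Xi> f \<longleftrightarrow>
    (\<forall>L. L \<subseteq> A \<longrightarrow> preimage_on A f L \<in> Latt_inf A \<Xi> L)"
proof (intro iffI allI impI)
  fix L
  assume "stable_preorder_preserving A \<Xi> f"
  moreover have "stable_preorder A \<Xi> (specialization A (Latt_inf A \<Xi> L))"
    by (intro stable_preorder_specialization assms(1) Latt_inf.preimage)
  ultimately have "preserves f (specialization A (Latt_inf A \<Xi> L))"
    by (simp add: stable_preorder_preserving_def)
  \<comment> \<open>The equation is applied by one substitution, as its right side again contains
    \<open>preimage_on A f L\<close>; arbitrary unions and intersections then stay in
    \<open>Latt_inf\<close>.\<close>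
  from preimage_on_eq_Union_specialization[OF this Latt_inf.base]
  show "preimage_on A f L \<in> Latt_inf A \<Xi> L"
    by (rule ssubst) (rule Latt_inf.union, elim imageE, hypsubst, rule Latt_inf.inter, simp)
next
  assume pre: "\<forall>L. L \<subseteq> A \<longrightarrow> preimage_on A f L \<in> Latt_inf A \<Xi> L"
  show "stable_preorder_preserving A \<Xi> f"
    unfolding stable_preorder_preserving_def
  proof (intro allI impI)
    fix \<rho>
    assume \<rho>: "stable_preorder A \<Xi> \<rho>"
    show "preserves f \<rho>"
    proof (rule preserves_if_preimage_upsets[OF \<rho> assms(2)])
      fix L
      assume L: "L \<subseteq> A" "\<rho> `` L \<subseteq> L"
      with pre have "preimage_on A f L \<in> Latt_inf A \<Xi> L" by simp
      then show "\<rho> `` preimage_on A f L \<subseteq> preimage_on A f L"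
        by (rule Latt_inf_upset[OF assms(1) \<rho> L(2)])
    qed
  qed
qed

text \<open>Closure under complements makes the specialization preorder symmetric, hence a
  congruence to which the preservation assumption applies.\<close>

lemma congruence_preserving_iff_Bool_inf:
  assumes "algebra A \<Xi>" "f \<in> A \<rightarrow> A"
  shows "congruence_preserving A \<Xi> f \<longleftrightarrow>
    (\<forall>L. L \<subseteq> A \<longrightarrow> preimage_on A f L \<in> Bool_inf A \<Xi> L)"
proof (intro iffI allI impI)
  fix L
  assume "congruence_preserving A \<Xi> f"
  moreover have "stable_preorder A \<Xi> (specialization A (Bool_inf A \<Xi> L))"
    by (intro stable_preorder_specialization assms(1) Bool_inf.preimage)
  moreover have "sym (specialization A (Bool_inf A \<Xi> L))"
    by (intro sym_specialization Bool_inf.compl)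
  ultimately have "preserves f (specialization A (Bool_inf A \<Xi> L))"
    by (simp add: congruence_preserving_def congruence_iff_sym_stable_preorder)
  from preimage_on_eq_Union_specialization[OF this Bool_inf.base]
  show "preimage_on A f L \<in> Bool_inf A \<Xi> L"
    by (rule ssubst) (rule Bool_inf.union, elim imageE, hypsubst, rule Bool_inf.inter, simp)
next
  assume pre: "\<forall>L. L \<subseteq> A \<longrightarrow> preimage_on A f L \<in> Bool_inf A \<Xi> L"
  show "congruence_preserving A \<Xi> f"
    unfolding congruence_preserving_def congruence_iff_sym_stable_preorder
  proof (intro allI impI, elim conjE)
    fix \<theta>
    assume \<theta>: "stable_preorder A \<Xi> \<theta>" "sym \<theta>"
    show "preserves f \<theta>"
    proof (rule preserves_if_preimage_upsets[OF \<theta>(1) assms(2)])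
      fix L
      assume L: "L \<subseteq> A" "\<theta> `` L \<subseteq> L"
      with pre have "preimage_on A f L \<in> Bool_inf A \<Xi> L" by simp
      then show "\<theta> `` preimage_on A f L \<subseteq> preimage_on A f L"
        by (rule Bool_inf_upset[OF assms(1) \<theta> L(2)])
    qed
  qed
qed

text \<open>A congruence \<open>\<theta>\<close> recognizing \<open>L\<close> saturates all of
  \<open>Latt_fin A \<Xi> L\<close>. This yields both the finiteness of that lattice and the finite
  index of its specialization preorder.\<close>

lemma preserves_finite_index_stable_preorders_iff_Latt_fin:
  assumes "algebra A \<Xi>" "f \<in> A \<rightarrow> A"
  shows "(\<forall>\<rho>. finite_index_stable_preorder A \<Xi> \<rho> \<longrightarrow> preserves f \<rho>) \<longleftrightarrow>
    (\<forall>L. recognizable A \<Xi> L \<longrightarrow> preimage_on A f L \<in> Latt_fin A \<Xi> L)"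
proof (intro iffI allI impI)
  fix L
  assume pres: "\<forall>\<rho>. finite_index_stable_preorder A \<Xi> \<rho> \<longrightarrow> preserves f \<rho>"
  assume "recognizable A \<Xi> L"
  then obtain \<theta> where \<theta>: "finite_index_congruence A \<Xi> \<theta>" "\<theta> `` L \<subseteq> L" and L: "L \<subseteq> A"
    by (auto simp: recognizable_iff)
  have eq: "equiv A \<theta>" "finite (A // \<theta>)" "stable_preorder A \<Xi> \<theta>"
    using \<theta>(1) congruence_iff_sym_stable_preorder[of A \<Xi> \<theta>]
    by (auto simp: finite_index_congruence_def congruence_def)
  let ?\<D> = "Latt_fin A \<Xi> L"
  have up: "\<theta> `` X \<subseteq> X" if "X \<in> ?\<D>" for X
    using Latt_fin_upset[OF assms(1) eq(3) \<theta>(2) that] .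
  then have fin: "finite ?\<D>"
    using Latt_fin_subset[OF L] finite_saturated_sets[OF eq(1,2)]
    by (elim rev_finite_subset) blast
  have "stable_preorder A \<Xi> (specialization A ?\<D>)"
    by (intro stable_preorder_specialization assms(1) Latt_fin.preimage)
  then have "preserves f (specialization A ?\<D>)"
    using pres finite_index_specialization[OF \<theta>(1) up] by blast
  with fin show "preimage_on A f L \<in> ?\<D>"
    by (intro preimage_on_in_finite_lattice) (auto intro: Latt_fin.intros)
next
  fix \<rho>
  assume pre: "\<forall>L. recognizable A \<Xi> L \<longrightarrow> preimage_on A f L \<in> Latt_fin A \<Xi> L"
  assume "finite_index_stable_preorder A \<Xi> \<rho>"
  then have \<rho>: "stable_preorder A \<Xi> \<rho>" "finite_index_congruence A \<Xi> (\<rho> \<inter> \<rho>\<inverse>)"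
    by (auto simp: finite_index_stable_preorder_iff)
  show "preserves f \<rho>"
  proof (rule preserves_if_preimage_upsets[OF \<rho>(1) assms(2)])
    fix L
    assume L: "L \<subseteq> A" "\<rho> `` L \<subseteq> L"
    \<comment> \<open>Up-sets of \<open>\<rho>\<close> are unions of classes of the associated
      finite index congruence, so they are recognizable and \<open>pre\<close> applies to
      them.\<close>
    then have "(\<rho> \<inter> \<rho>\<inverse>) `` L \<subseteq> L" by blast
    with \<rho>(2) L(1) have "recognizable A \<Xi> L" by (auto simp only: recognizable_iff)
    with pre have "preimage_on A f L \<in> Latt_fin A \<Xi> L" by simp
    then show "\<rho> `` preimage_on A f L \<subseteq> preimage_on A f L"
      by (rule Latt_fin_upset[OF assms(1) \<rho>(1) L(2)])
  qed
qed

lemma preserves_finite_index_congruences_iff_Bool_fin: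
  assumes "algebra A \<Xi>" "f \<in> A \<rightarrow> A"
  shows "(\<forall>\<theta>. finite_index_congruence A \<Xi> \<theta> \<longrightarrow> preserves f \<theta>) \<longleftrightarrow>
    (\<forall>L. recognizable A \<Xi> L \<longrightarrow> preimage_on A f L \<in> Bool_fin A \<Xi> L)"
proof (intro iffI allI impI)
  fix L
  assume pres: "\<forall>\<theta>. finite_index_congruence A \<Xi> \<theta> \<longrightarrow> preserves f \<theta>"
  assume "recognizable A \<Xi> L"
  then obtain \<theta> where \<theta>: "finite_index_congruence A \<Xi> \<theta>" "\<theta> `` L \<subseteq> L" and L: "L \<subseteq> A"
    by (auto simp: recognizable_iff)
  have eq: "equiv A \<theta>" "finite (A // \<theta>)" "stable_preorder A \<Xi> \<theta>" "sym \<theta>"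
    using \<theta>(1) congruence_iff_sym_stable_preorder[of A \<Xi> \<theta>]
    by (auto simp: finite_index_congruence_def congruence_def)
  let ?\<D> = "Bool_fin A \<Xi> L"
  have up: "\<theta> `` X \<subseteq> X" if "X \<in> ?\<D>" for X
    using Bool_fin_upset[OF assms(1) eq(3,4) \<theta>(2) that] .
  then have fin: "finite ?\<D>"
    using Bool_fin_subset[OF L] finite_saturated_sets[OF eq(1,2)]
    by (elim rev_finite_subset) blast
  have "stable_preorder A \<Xi> (specialization A ?\<D>)"
    by (intro stable_preorder_specialization assms(1) Bool_fin.preimage)
  moreover have "sym (specialization A ?\<D>)"
    by (intro sym_specialization Bool_fin.compl)
  ultimately have "preserves f (specialization A ?\<D>)"
    using pres finite_index_specialization[OF \<theta>(1) up] by (simp add: finite_index_congruence_iff)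
  with fin show "preimage_on A f L \<in> ?\<D>"
    by (intro preimage_on_in_finite_lattice) (auto intro: Bool_fin.intros)
next
  fix \<theta>
  assume pre: "\<forall>L. recognizable A \<Xi> L \<longrightarrow> preimage_on A f L \<in> Bool_fin A \<Xi> L"
  assume fic: "finite_index_congruence A \<Xi> \<theta>"
  then have \<theta>: "stable_preorder A \<Xi> \<theta>" "sym \<theta>"
    by (auto simp: finite_index_congruence_iff finite_index_stable_preorder_def)
  show "preserves f \<theta>"
  proof (rule preserves_if_preimage_upsets[OF \<theta>(1) assms(2)])
    fix L
    assume L: "L \<subseteq> A" "\<theta> `` L \<subseteq> L"
    with fic have "recognizable A \<Xi> L" by (auto simp only: recognizable_iff)
    with pre have "preimage_on A f L \<in> Bool_fin A \<Xi> L" by simp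
    then show "\<theta> `` preimage_on A f L \<subseteq> preimage_on A f L"
      by (rule Bool_fin_upset[OF assms(1) \<theta> L(2)])
  qed
qed

section \<open>Residual finiteness\<close>

text \<open>The factor \<open>A \<times> A\<close>, which is all that remains for an empty family,
  is preserved because \<open>f\<close> maps \<open>A\<close> into itself.\<close>

lemma preserves_carrier_Inter:
  assumes "f \<in> A \<rightarrow> A" "\<And>\<sigma>. \<sigma> \<in> \<F> \<Longrightarrow> preserves f \<sigma>"
  shows "preserves f ((A \<times> A) \<inter> \<Inter>\<F>)"
  using assms by (fastforce simp: preserves_def)

lemma sp_residually_finite_stable_preorder_preserving:
  assumes "sp_residually_finite A \<Xi>" "f \<in> A \<rightarrow> A"
    "\<And>\<rho>. finite_index_stable_preorder A \<Xi> \<rho> \<Longrightarrow> preserves f \<rho>"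
  shows "stable_preorder_preserving A \<Xi> f"
  using assms preserves_carrier_Inter
  unfolding stable_preorder_preserving_def sp_residually_finite_def by metis

lemma c_residually_finite_congruence_preserving:
  assumes "c_residually_finite A \<Xi>" "f \<in> A \<rightarrow> A"
    "\<And>\<theta>. finite_index_congruence A \<Xi> \<theta> \<Longrightarrow> preserves f \<theta>"
  shows "congruence_preserving A \<Xi> f"
  using assms preserves_carrier_Inter
  unfolding congruence_preserving_def c_residually_finite_def by metis

text \<open>A congruence equals its intersection with its converse, so each finite index preorder
  \<open>\<sigma>\<close> in a family representing it can be replaced by the finite index congruence
  \<open>\<sigma> \<inter> \<sigma>\<inverse>\<close>.\<close>

lemma sp_residually_finite_imp_c_residually_finite:
  assumes "sp_residually_finite A \<Xi>"
  shows "c_residually_finite A \<Xi>"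
  unfolding c_residually_finite_def
proof (intro allI impI)
  fix \<theta>
  assume "congruence A \<Xi> \<theta>"
  then have \<theta>: "stable_preorder A \<Xi> \<theta>" "sym \<theta>"
    by (auto simp: congruence_iff_sym_stable_preorder)
  then obtain \<F> where \<F>: "\<And>\<sigma>. \<sigma> \<in> \<F> \<Longrightarrow> finite_index_stable_preorder A \<Xi> \<sigma>"
    "\<theta> = (A \<times> A) \<inter> \<Inter>\<F>"
    using assms unfolding sp_residually_finite_def by metis
  have "\<theta> = \<theta> \<inter> \<theta>\<inverse>" using \<theta>(2) by (auto simp: sym_def)
  also have "\<dots> = (A \<times> A) \<inter> \<Inter>((\<lambda>\<sigma>. \<sigma> \<inter> \<sigma>\<inverse>) ` \<F>)" unfolding \<F>(2) by auto
  finally have "\<theta> = (A \<times> A) \<inter> \<Inter>((\<lambda>\<sigma>. \<sigma> \<inter> \<sigma>\<inverse>) ` \<F>)" .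
  moreover have "\<forall>\<phi> \<in> (\<lambda>\<sigma>. \<sigma> \<inter> \<sigma>\<inverse>) ` \<F>. finite_index_congruence A \<Xi> \<phi>"
    using \<F>(1) finite_index_stable_preorder_iff by blast
  ultimately show
    "\<exists>\<F>. (\<forall>\<phi>\<in>\<F>. finite_index_congruence A \<Xi> \<phi>) \<and> \<theta> = (A \<times> A) \<inter> \<Inter>\<F>" by blast
qed

lemma stable_preorder_preserving_imp_congruence_preserving:
  "stable_preorder_preserving A \<Xi> f \<Longrightarrow> congruence_preserving A \<Xi> f"
  by (simp add: stable_preorder_preserving_def congruence_preserving_def
      congruence_iff_sym_stable_preorder)

theorem theorem5p13:
  fixes A :: "'a set" and \<Xi> :: "'a operation set" and f :: "'a \<Rightarrow> 'a"
  assumes "algebra A \<Xi>" and "f \<in> A \<rightarrow> A"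
  shows
    "(sp_residually_finite A \<Xi> \<longrightarrow>
       ((\<forall>\<rho>. finite_index_stable_preorder A \<Xi> \<rho> \<longrightarrow> preserves f \<rho>) \<longrightarrow>
         stable_preorder_preserving A \<Xi> f \<and> congruence_preserving A \<Xi> f) \<and>
       ((stable_preorder_preserving A \<Xi> f \<longleftrightarrow>
           (\<forall>\<rho>. finite_index_stable_preorder A \<Xi> \<rho> \<longrightarrow> preserves f \<rho>)) \<and>
        (stable_preorder_preserving A \<Xi> f \<longleftrightarrow>
           (\<forall>L. L \<subseteq> A \<longrightarrow> preimage_on A f L \<in> Latt_inf A \<Xi> L)) \<and>
        (stable_preorder_preserving A \<Xi> f \<longleftrightarrow>
           (\<forall>L. recognizable A \<Xi> L \<longrightarrow> preimage_on A f L \<in> Latt_fin A \<Xi> L))) \<and>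
       ((congruence_preserving A \<Xi> f \<longleftrightarrow>
           (\<forall>\<theta>. finite_index_congruence A \<Xi> \<theta> \<longrightarrow> preserves f \<theta>)) \<and>
        (congruence_preserving A \<Xi> f \<longleftrightarrow>
           (\<forall>L. L \<subseteq> A \<longrightarrow> preimage_on A f L \<in> Bool_inf A \<Xi> L)) \<and>
        (congruence_preserving A \<Xi> f \<longleftrightarrow>
           (\<forall>L. recognizable A \<Xi> L \<longrightarrow> preimage_on A f L \<in> Bool_fin A \<Xi> L)))) \<and>
     (c_residually_finite A \<Xi> \<longrightarrow>
       ((\<forall>\<theta>. finite_index_congruence A \<Xi> \<theta> \<longrightarrow> preserves f \<theta>) \<longrightarrow>
         congruence_preserving A \<Xi> f) \<and>
       ((congruence_preserving A \<Xi> f \<longleftrightarrow>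
           (\<forall>\<theta>. finite_index_congruence A \<Xi> \<theta> \<longrightarrow> preserves f \<theta>)) \<and>
        (congruence_preserving A \<Xi> f \<longleftrightarrow>
           (\<forall>L. L \<subseteq> A \<longrightarrow> preimage_on A f L \<in> Bool_inf A \<Xi> L)) \<and>
        (congruence_preserving A \<Xi> f \<longleftrightarrow>
           (\<forall>L. recognizable A \<Xi> L \<longrightarrow> preimage_on A f L \<in> Bool_fin A \<Xi> L))))"
proof -
  have sp: "stable_preorder_preserving A \<Xi> f \<longleftrightarrow>
      (\<forall>\<rho>. finite_index_stable_preorder A \<Xi> \<rho> \<longrightarrow> preserves f \<rho>)"
    if "sp_residually_finite A \<Xi>"
    using sp_residually_finite_stable_preorder_preserving[OF that assms(2)]
    by (auto simp: stable_preorder_preserving_def finite_index_stable_preorder_def)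
  have c: "congruence_preserving A \<Xi> f \<longleftrightarrow>
      (\<forall>\<theta>. finite_index_congruence A \<Xi> \<theta> \<longrightarrow> preserves f \<theta>)"
    if "c_residually_finite A \<Xi>"
    using c_residually_finite_congruence_preserving[OF that assms(2)]
    by (auto simp: congruence_preserving_def finite_index_congruence_def)
  \<comment> \<open>Only propositional reasoning remains; in (1) the four conditions on congruences
    are obtained from \<open>c\<close>, since sp-residual finiteness implies c-residual
    finiteness.\<close>
  show ?thesis
    using sp c sp_residually_finite_imp_c_residually_finite[of A \<Xi>]
      stable_preorder_preserving_imp_congruence_preserving[of A \<Xi> f]
      stable_preorder_preserving_iff_Latt_inf[OF assms]
      congruence_preserving_iff_Bool_inf[OF assms]
      preserves_finite_index_stable_preorders_iff_Latt_fin[OF assms]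
      preserves_finite_index_congruences_iff_Bool_fin[OF assms]
    by argo
qed

end
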